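(* Let $G$ be a $K_4$-free graph with $n$ vertices and $e$ edges, and put $k = e - n^2/4$. Then $G$ contains at least $\lceil k\rceil$ pairwise edge-disjoint triangles.
   Context: A graph is $K_4$-free if it contains no complete subgraph on $4$ vertices. Triangles are edge-disjoint if no edge of $G$ belongs to two of them. The value $k$ is a real number (possibly non-integer or non-positive). *)

theory Defs
  imports Complex_Main
begin

definition simple_graph :: "'a set \<Rightarrow> 'a set set \<Rightarrow> bool" where
  "simple_graph V E \<longleftrightarrow> finite V \<and> (\<forall>e\<in>E. e \<subseteq> V \<and> card e = 2)"

definition is_clique :: "'a set set \<Rightarrow> 'a set \<Rightarrow> bool" where
  "is_clique E S \<longleftrightarrow> (\<forall>x\<in>S. \<forall>y\<in>S. x \<noteq> y \<longrightarrow> {x, y} \<in> E)"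

definition K4_free :: "'a set \<Rightarrow> 'a set set \<Rightarrow> bool" where
  "K4_free V E \<longleftrightarrow> \<not> (\<exists>S. S \<subseteq> V \<and> card S = 4 \<and> is_clique E S)"

definition is_triangle :: "'a set \<Rightarrow> 'a set set \<Rightarrow> 'a set \<Rightarrow> bool" where
  "is_triangle V E t \<longleftrightarrow> t \<subseteq> V \<and> card t = 3 \<and> is_clique E t"

definition tri_edges :: "'a set \<Rightarrow> 'a set set" where
  "tri_edges t = {e. e \<subseteq> t \<and> card e = 2}"

definition edge_disjoint_triangles :: "'a set \<Rightarrow> 'a set set \<Rightarrow> 'a set set \<Rightarrow> bool" where
  "edge_disjoint_triangles V E T \<longleftrightarrow>
     (\<forall>t\<in>T. is_triangle V E t) \<and>
     (\<forall>t1\<in>T. \<forall>t2\<in>T. t1 \<noteq> t2 \<longrightarrow> tri_edges t1 \<inter> tri_edges t2 = {})"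

end

theory Submission
  imports Defs "HOL-Number_Theory.Cong"
begin

text \<open>
  Let \<open>m\<close> be the least number of cliques into which the vertices can be partitioned, and number the
  cliques by residues modulo \<open>m\<close>. Two triangles that share an edge and have the same sum of
  numbers have their third vertices in the same clique, so together they form a \<open>K\<^sub>4\<close>. Hence the
  triangles with a given sum are edge-disjoint, and some sum occurs for at least \<open>T / m\<close> of the
  \<open>T\<close> triangles of the graph. It remains to show \<open>T \<ge> m k\<close>.

  For a vertex set \<open>A\<close> put \<open>f\<^sub>A(x) = \<Sum> (-x)\<^bsup>|C|\<^esup>\<close>, summed over the cliques \<open>C \<subseteq> A\<close>. Let \<open>r\<close> be the
  least positive zero of all these polynomials. The recursion
  \<open>f\<^sub>A = f\<^bsub>A - v\<^esub> - x f\<^bsub>A \<inter> N(v)\<^esub>\<close> shows that \<open>f\<^sub>A(r)\<close> decreases in \<open>A\<close>, so that \<open>f\<^sub>V(r) \<le> 0\<close>, that is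
  \<open>T r\<^sup>3 \<ge> 1 - n r + e r\<^sup>2 = (1 - n r / 2)\<^sup>2 + k r\<^sup>2\<close>, and therefore \<open>T \<ge> k / r\<close>.
  Finally \<open>r \<le> 1 / m\<close>: in a minimal vertex set \<open>S\<close> that is not covered by \<open>m - 1\<close> cliques,
  every vertex has at least \<open>m\<close> non-neighbours, itself included. If all \<open>f\<^sub>A(1/m)\<close> were positive,
  removing the non-neighbours of \<open>v\<close> from \<open>S\<close> one at a time would give
  \<open>f\<^bsub>S \<inter> N(v)\<^esub> \<ge> f\<^sub>S + (1/m) \<Sum> f\<^bsub>S \<inter> N(u)\<^esub>\<close>, which is absurd when \<open>f\<^bsub>S \<inter> N(v)\<^esub>\<close> is minimal.
\<close>

section \<open>Clique polynomials and their recursion\<close>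

definition neighbours :: "'a set set \<Rightarrow> 'a \<Rightarrow> 'a set" where
  "neighbours E v = {u. u \<noteq> v \<and> {v, u} \<in> E}"

definition cliques :: "'a set set \<Rightarrow> 'a set \<Rightarrow> 'a set set" where
  "cliques E A = {C. C \<subseteq> A \<and> is_clique E C}"

text \<open>For finite \<open>A\<close> this is the independence polynomial of the complement graph
  at \<open>-x\<close>; the empty clique contributes the constant term 1.\<close>

definition clique_poly :: "'a set set \<Rightarrow> 'a set \<Rightarrow> real \<Rightarrow> real" where
  "clique_poly E A x = (\<Sum>C\<in>cliques E A. (- x) ^ card C)"

lemma finite_cliques [simp]: "finite A \<Longrightarrow> finite (cliques E A)"
  unfolding cliques_def by simp

lemma cliques_split:
  assumes "v \<in> A"
  shows "cliques E A = cliques E (A - {v}) \<union> insert v ` cliques E (A \<inter> neighbours E v)"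
proof (intro set_eqI iffI)
  fix C assume C: "C \<in> cliques E A"
  show "C \<in> cliques E (A - {v}) \<union> insert v ` cliques E (A \<inter> neighbours E v)"
  proof (cases "v \<in> C")
    case True
    then have "C - {v} \<in> cliques E (A \<inter> neighbours E v)"
      using C by (auto simp: cliques_def is_clique_def neighbours_def)
    moreover have "C = insert v (C - {v})" using True by auto
    ultimately show ?thesis by blast
  next
    case False
    then show ?thesis using C by (auto simp: cliques_def)
  qed
next
  fix C assume "C \<in> cliques E (A - {v}) \<union> insert v ` cliques E (A \<inter> neighbours E v)"
  then show "C \<in> cliques E A"
    using assms by (auto simp: cliques_def is_clique_def neighbours_def insert_commute)
qed

lemma clique_poly_rec:
  assumes "finite A" "v \<in> A"
  shows "clique_poly E A x
    = clique_poly E (A - {v}) x - x * clique_poly E (A \<inter> neighbours E v) x"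
proof -
  let ?N = "A \<inter> neighbours E v"
  have notin: "v \<notin> C" if "C \<in> cliques E ?N" for C
    using that by (auto simp: cliques_def neighbours_def)
  have fin: "finite C" if "C \<in> cliques E ?N" for C
    using that assms(1) finite_subset[of C A] by (auto simp: cliques_def)
  have inj: "inj_on (insert v) (cliques E ?N)"
    using notin by (intro inj_onI) (metis insert_ident)
  have disj: "cliques E (A - {v}) \<inter> insert v ` cliques E ?N = {}"
    by (auto simp: cliques_def)
  have "clique_poly E A x = clique_poly E (A - {v}) x
      + (\<Sum>C\<in>insert v ` cliques E ?N. (- x) ^ card C)"
    unfolding clique_poly_def cliques_split[OF assms(2), of E]
    using assms(1) disj by (intro sum.union_disjoint) auto
  also have "(\<Sum>C\<in>insert v ` cliques E ?N. (- x) ^ card C)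
      = (\<Sum>C\<in>cliques E ?N. (- x) * (- x) ^ card C)"
    unfolding sum.reindex[OF inj] using notin fin by (intro sum.cong) auto
  also have "\<dots> = - x * clique_poly E ?N x"
    unfolding clique_poly_def sum_distrib_left ..
  finally show ?thesis by simp
qed

lemma clique_poly_0:
  assumes "finite A"
  shows "clique_poly E A 0 = 1"
proof -
  have "clique_poly E A 0 = (\<Sum>C\<in>cliques E A. if C = {} then 1 else 0)"
    unfolding clique_poly_def
    using assms by (intro sum.cong) (auto simp: cliques_def power_0_left dest: finite_subset)
  also have "\<dots> = 1"
    using assms by (simp add: sum.delta cliques_def is_clique_def)
  finally show ?thesis .
qed

lemma continuous_on_clique_poly: "continuous_on X (clique_poly E A)"
  unfolding clique_poly_def by (intro continuous_intros)

lemma clique_poly_antimono: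
  assumes "finite B" "A \<subseteq> B" "x \<ge> 0" and nonneg: "\<And>C. C \<subseteq> B \<Longrightarrow> clique_poly E C x \<ge> 0"
  shows "clique_poly E B x \<le> clique_poly E A x"
proof -
  have "clique_poly E (A \<union> D) x \<le> clique_poly E A x" if "finite D" "D \<subseteq> B - A" for D
    using that
  proof (induction D rule: finite_induct)
    case (insert v D)
    have "clique_poly E (A \<union> insert v D) x
        = clique_poly E (A \<union> D) x - x * clique_poly E ((A \<union> insert v D) \<inter> neighbours E v) x"
      using clique_poly_rec[of "A \<union> insert v D" v E x] insert assms(1,2)
      by (auto simp: insert_Diff_if finite_subset Un_Diff)
    moreover have "x * clique_poly E ((A \<union> insert v D) \<inter> neighbours E v) x \<ge> 0"
      using insert.prems assms(2,3) by (intro mult_nonneg_nonneg nonneg) auto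
    ultimately show ?case using insert by auto
  qed simp
  from this[of "B - A"] show ?thesis
    using assms(1,2) by (simp add: Un_absorb1)
qed

text \<open>By the recursion, deleting \<open>u\<close> from \<open>S - D\<close> adds
  \<open>x\<close> times the polynomial of its neighbourhood in \<open>S - D\<close>. By
  antitonicity that is at least the polynomial of its neighbourhood in \<open>S\<close>.\<close>

lemma clique_poly_remove:
  assumes "finite S" "D \<subseteq> S" "x \<ge> 0" and nonneg: "\<And>C. C \<subseteq> S \<Longrightarrow> clique_poly E C x \<ge> 0"
  shows "clique_poly E (S - D) x
    \<ge> clique_poly E S x + x * (\<Sum>u\<in>D. clique_poly E (S \<inter> neighbours E u) x)"
proof -
  have "finite D" using assms finite_subset by blast
  then show ?thesis using assms(2)
  proof (induction D rule: finite_induct)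
    case (insert u D)
    have "clique_poly E (S - D) x = clique_poly E (S - insert u D) x
        - x * clique_poly E ((S - D) \<inter> neighbours E u) x"
      using clique_poly_rec[of "S - D" u E x] insert assms(1)
      by (simp add: Diff_insert[symmetric])
    moreover have "x * clique_poly E (S \<inter> neighbours E u) x
        \<le> x * clique_poly E ((S - D) \<inter> neighbours E u) x"
      using assms(1,3) by (intro mult_left_mono clique_poly_antimono nonneg) auto
    ultimately show ?case using insert by (simp add: distrib_left)
  qed simp
qed

section \<open>Points where a clique polynomial is not positive\<close>

lemma clique_poly_nonpos_ex:
  assumes "finite S" "S \<noteq> {}" "m > 0"
    and many: "\<And>v. v \<in> S \<Longrightarrow> card (S - neighbours E v) \<ge> m"
  shows "\<exists>A\<subseteq>S. clique_poly E A (1 / real m) \<le> 0"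
proof (rule ccontr)
  define x where "x = 1 / real m"
  define g where "g u = clique_poly E (S \<inter> neighbours E u) x" for u
  assume "\<not> ?thesis"
  then have pos: "clique_poly E A x > 0" if "A \<subseteq> S" for A
    using that by (auto simp: x_def not_le)
  \<comment> \<open>At a minimiser of \<open>g\<close>, there are at least \<open>m\<close>
    summands, each at least \<open>g v\<close>, which compensates the factor
    \<open>1 / m\<close>.\<close>
  define v where "v = arg_min_on g S"
  have v: "v \<in> S" "\<And>u. u \<in> S \<Longrightarrow> g v \<le> g u"
    using arg_min_if_finite(1)[of S g] arg_min_least[of S _ g] assms(1,2)
    by (auto simp: v_def)
  have "real m * g v \<le> real (card (S - neighbours E v)) * g v"
    using many[OF v(1)] pos by (intro mult_right_mono) (auto simp: g_def less_imp_le)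
  also have "\<dots> \<le> (\<Sum>u\<in>S - neighbours E v. g u)"
    using v(2) by (intro sum_bounded_below) auto
  finally have "x * (real m * g v) \<le> x * (\<Sum>u\<in>S - neighbours E v. g u)"
    by (intro mult_left_mono) (auto simp: x_def)
  then have "g v \<le> x * (\<Sum>u\<in>S - neighbours E v. g u)"
    using assms(3) by (simp add: x_def)
  moreover have "g v \<ge> clique_poly E S x + x * (\<Sum>u\<in>S - neighbours E v. g u)"
    using clique_poly_remove[of S "S - neighbours E v" x E] assms(1) pos
    by (simp add: g_def x_def Diff_Diff_Int less_imp_le)
  ultimately show False using pos[of S] by simp
qed

lemma clique_poly_whole_nonpos:
  assumes "finite V" "A \<subseteq> V" "x0 \<ge> 0" "clique_poly E A x0 \<le> 0"
  shows "\<exists>r. 0 < r \<and> r \<le> x0 \<and> clique_poly E V r \<le> 0"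
proof -
  \<comment> \<open>A finite union of closed sets inside an interval is compact, so a least point
    \<open>r\<close> exists, common to all subsets of \<open>V\<close>.\<close>
  define Z where "Z = (\<Union>B\<in>Pow V. {0..x0} \<inter> {x. clique_poly E B x \<le> 0})"
  have "closed ({0..x0} \<inter> {x. clique_poly E B x \<le> 0})" for B
    by (intro closed_Int closed_Collect_le continuous_on_clique_poly) auto
  then have "closed Z" unfolding Z_def using assms(1) by (intro closed_UN) auto
  moreover have "Z \<subseteq> {0..x0}" by (auto simp: Z_def)
  ultimately have "compact Z" by (metis compact_Icc compact_Int_closed inf.absorb2)
  moreover have "x0 \<in> Z" using assms by (auto simp: Z_def)
  ultimately obtain r where r: "r \<in> Z" "\<And>x. x \<in> Z \<Longrightarrow> r \<le> x"
    using compact_attains_inf[of Z] by blast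
  then obtain B where B: "B \<subseteq> V" "clique_poly E B r \<le> 0" "0 \<le> r" "r \<le> x0"
    by (auto simp: Z_def)
  have "r \<noteq> 0" using B clique_poly_0[of B E] assms(1) by (auto dest: finite_subset)
  then have "r > 0" using B by simp
  \<comment> \<open>Strictly between 0 and \<open>r\<close> every such polynomial is positive by
    minimality of \<open>r\<close>; continuity from the left gives the weak inequality at
    \<open>r\<close>.\<close>
  have "clique_poly E C r \<ge> 0" if "C \<subseteq> V" for C
  proof (rule tendsto_lowerbound)
    show "(clique_poly E C \<longlongrightarrow> clique_poly E C r) (at_left r)"
      using continuous_on_clique_poly[of UNIV E C]
      by (auto simp: continuous_on_def intro: filterlim_mono at_le)
    show "\<forall>\<^sub>F x in at_left r. 0 \<le> clique_poly E C x"
      using eventually_at_left_real[OF \<open>r > 0\<close>]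
    proof eventually_elim
      case (elim x)
      then have "x \<notin> Z" using r(2)[of x] by auto
      then have "\<not> clique_poly E C x \<le> 0"
        using that elim B(4) unfolding Z_def by auto
      then show ?case by simp
    qed
  qed simp
  then have "clique_poly E V r \<le> clique_poly E B r"
    using assms(1) B by (intro clique_poly_antimono) auto
  then show ?thesis using B \<open>r > 0\<close> by (intro exI[of _ r]) auto
qed

text \<open>A clique with four or more vertices would contain a \<open>K4\<close>. Grouping the
  others by size counts the empty set, vertices, edges and triangles.\<close>

lemma clique_poly_K4_free:
  assumes "simple_graph V E" "K4_free V E"
  shows "clique_poly E V x
    = 1 - real (card V) * x + real (card E) * x\<^sup>2 - real (card {t. is_triangle V E t}) * x ^ 3"
proof -
  have fin: "finite V" using assms(1) by (simp add: simple_graph_def)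
  define K where "K j = {C \<in> cliques E V. card C = j}" for j
  have small: "card C < 4" if C: "C \<in> cliques E V" for C
  proof (rule ccontr)
    assume "\<not> card C < 4"
    then obtain D where "D \<subseteq> C" "card D = 4"
      using obtain_subset_with_card_n[of 4 C] by (auto simp: not_less)
    moreover have "D \<subseteq> V" "is_clique E D"
      using C \<open>D \<subseteq> C\<close> by (auto simp: cliques_def is_clique_def)
    ultimately show False
      using assms(2) unfolding K4_free_def by blast
  qed
  have K0: "K 0 = {{}}"
    using fin by (auto simp: K_def cliques_def is_clique_def dest: finite_subset)
  have "K 1 = (\<lambda>v. {v}) ` V"
    by (auto simp: K_def cliques_def is_clique_def card_1_singleton_iff)
  then have K1: "card (K 1) = card V" by (simp add: card_image)
  have K2: "K 2 = E"
  proof (intro set_eqI iffI)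
    fix C assume "C \<in> K 2"
    then show "C \<in> E" by (auto simp: K_def cliques_def is_clique_def card_2_iff)
  next
    fix C assume C: "C \<in> E"
    then have "C \<subseteq> V" "card C = 2" using assms(1) by (auto simp: simple_graph_def)
    moreover have "is_clique E C"
      unfolding is_clique_def
    proof (intro ballI impI)
      fix x y assume "x \<in> C" "y \<in> C" "x \<noteq> y"
      then have "C = {x, y}" using \<open>card C = 2\<close> by (auto simp: card_2_iff)
      then show "{x, y} \<in> E" using C by simp
    qed
    ultimately show "C \<in> K 2" by (simp add: K_def cliques_def)
  qed
  have K3: "K 3 = {t. is_triangle V E t}"
    by (auto simp: K_def cliques_def is_triangle_def)
  have by_size: "(\<Sum>C\<in>K j. (- x) ^ card C) = real (card (K j)) * (- x) ^ j" for j
    by (simp add: K_def)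
  have "clique_poly E V x = (\<Sum>j\<in>{0, 1, 2, 3}. \<Sum>C\<in>K j. (- x) ^ card C)"
    unfolding clique_poly_def K_def using small fin
    by (intro sum.group[symmetric]) (force simp: eval_nat_numeral less_Suc_eq)+
  also have "\<dots> = (\<Sum>j\<in>{0, 1, 2, 3}. real (card (K j)) * (- x) ^ j)"
    unfolding by_size ..
  also have "\<dots> = real (card (K 0)) + (real (card (K 1)) * (- x)
      + (real (card (K 2)) * (- x)\<^sup>2 + real (card (K 3)) * (- x) ^ 3))"
    by simp
  finally show ?thesis
    unfolding K0 K1 K2 K3 by (simp add: power3_eq_cube)
qed

section \<open>Clique partitions as proper colourings of the complement graph\<close>

definition clique_colouring :: "'a set set \<Rightarrow> 'a set \<Rightarrow> nat \<Rightarrow> ('a \<Rightarrow> nat) \<Rightarrow> bool" where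
  "clique_colouring E S m c \<longleftrightarrow>
     (\<forall>v\<in>S. c v < m) \<and> (\<forall>u\<in>S. \<forall>v\<in>S. u \<noteq> v \<and> c u = c v \<longrightarrow> {u, v} \<in> E)"

text \<open>The set \<open>S - neighbours E v\<close> contains \<open>v\<close> itself, so at most
  \<open>j - 1\<close> other vertices are non-neighbours of \<open>v\<close>. Some colour below
  \<open>j\<close> is missing on them and can be given to \<open>v\<close>.\<close>

lemma clique_colouring_insert:
  assumes c: "clique_colouring E (S - {v}) j c" and v: "v \<in> S" "finite S"
    and few: "card (S - neighbours E v) \<le> j"
  shows "\<exists>c. clique_colouring E S j c"
proof -
  have "card (c ` (S - {v} - neighbours E v)) \<le> card (S - {v} - neighbours E v)"
    using v by (intro card_image_le) auto
  also have "\<dots> < card (S - neighbours E v)"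
    using v by (intro psubset_card_mono) (auto simp: neighbours_def)
  finally have "card (c ` (S - {v} - neighbours E v)) < card {..<j}"
    using few by simp
  then obtain i where i: "i < j" "i \<notin> c ` (S - {v} - neighbours E v)"
    by (metis card_mono finite_imageI finite_Diff lessThan_iff not_le subsetI v(2))
  have nb: "{v, u} \<in> E" if "u \<in> S" "u \<noteq> v" "c u = i" for u
    using that i(2) by (auto simp: neighbours_def)
  have "clique_colouring E S j (c(v := i))"
    using c i(1) nb unfolding clique_colouring_def by (auto simp: insert_commute)
  then show ?thesis by blast
qed

text \<open>Take \<open>m\<close> least possible for \<open>V\<close>, and \<open>S\<close> a
  smallest subset without a colouring by \<open>m - 1\<close> colours. A vertex of \<open>S\<close>
  with fewer than \<open>m\<close> non-neighbours could be removed and coloured last.\<close>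

lemma clique_colouring_critical:
  assumes "finite V" "V \<noteq> {}"
  shows "\<exists>m c S. clique_colouring E V m c \<and> m > 0 \<and> S \<subseteq> V \<and> S \<noteq> {}
    \<and> (\<forall>v\<in>S. card (S - neighbours E v) \<ge> m)"
proof -
  obtain h where "bij_betw h V {0..<card V}"
    using ex_bij_betw_finite_nat[OF assms(1)] by blast
  then have "clique_colouring E V (card V) h"
    by (auto simp: clique_colouring_def bij_betw_def inj_on_def)
  then have ex: "\<exists>m c. clique_colouring E V m c" by blast
  define m where "m = (LEAST m. \<exists>c. clique_colouring E V m c)"
  obtain c where c: "clique_colouring E V m c"
    using LeastI_ex[OF ex] by (auto simp: m_def)
  have "m > 0" using c assms(2) by (fastforce simp: clique_colouring_def)
  then have no: "\<nexists>c. clique_colouring E V (m - 1) c"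
    using not_less_Least[of "m - 1" "\<lambda>m. \<exists>c. clique_colouring E V m c"] by (auto simp: m_def)
  define P where "P S \<longleftrightarrow> S \<subseteq> V \<and> (\<nexists>c. clique_colouring E S (m - 1) c)" for S
  have "P V" using no by (simp add: P_def)
  then obtain S where S: "P S" "\<And>S'. P S' \<Longrightarrow> card S \<le> card S'"
    using ex_has_least_nat[of P V card] by blast
  have finS: "finite S" using S(1) assms(1) by (auto simp: P_def dest: finite_subset)
  have "S \<noteq> {}" using S(1) by (auto simp: P_def clique_colouring_def)
  moreover have "card (S - neighbours E v) \<ge> m" if "v \<in> S" for v
  proof (rule ccontr)
    assume "\<not> ?thesis"
    then have "card (S - neighbours E v) \<le> m - 1" by simp
    moreover have "\<not> P (S - {v})"
      using S(2)[of "S - {v}"] that finS by (meson card_Diff1_less leD)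
    ultimately show False
      using clique_colouring_insert[of E S v "m - 1"] that finS S(1) by (auto simp: P_def)
  qed
  ultimately show ?thesis
    using c \<open>m > 0\<close> S(1) unfolding P_def by blast
qed

section \<open>Lower bound on the number of all triangles\<close>

lemma K4_free_triangle_count:
  assumes G: "simple_graph V E" "K4_free V E" and "V \<noteq> {}"
  shows "\<exists>m c. clique_colouring E V m c \<and> m > 0
    \<and> real m * (real (card E) - (real (card V))\<^sup>2 / 4) \<le> real (card {t. is_triangle V E t})"
proof -
  define T where "T = real (card {t. is_triangle V E t})"
  define n where "n = real (card V)"
  define k where "k = real (card E) - n\<^sup>2 / 4"
  have fin: "finite V" using G by (simp add: simple_graph_def)
  obtain m c S where m: "clique_colouring E V m c" "m > 0" and S: "S \<subseteq> V" "S \<noteq> {}"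
    "\<forall>v\<in>S. card (S - neighbours E v) \<ge> m"
    using clique_colouring_critical[OF fin assms(3), of E] by blast
  obtain A where "A \<subseteq> S" "clique_poly E A (1 / real m) \<le> 0"
    using clique_poly_nonpos_ex[of S m E] S m fin by (auto dest: finite_subset)
  then obtain r where r: "0 < r" "r \<le> 1 / real m" "clique_poly E V r \<le> 0"
    using clique_poly_whole_nonpos[of V A "1 / real m" E] S fin by auto
  have "k * r\<^sup>2 \<le> (1 - n * r / 2)\<^sup>2 + k * r\<^sup>2" by simp
  also have "\<dots> = 1 - n * r + real (card E) * r\<^sup>2"
    by (simp add: k_def power2_eq_square algebra_simps)
  also have "\<dots> \<le> T * r ^ 3"
    using r(3) unfolding clique_poly_K4_free[OF G] T_def n_def by simp
  finally have "k * r\<^sup>2 \<le> (T * r) * r\<^sup>2"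
    by (simp add: power2_eq_square power3_eq_cube mult.assoc)
  then have "k \<le> T * r" using r(1) by simp
  \<comment> \<open>The bound on \<open>r\<close> is multiplied by \<open>T\<close>, which is
    nonnegative, so negative \<open>k\<close> is covered too.\<close>
  also have "\<dots> \<le> T * (1 / real m)"
    using r(2) by (intro mult_left_mono) (auto simp: T_def)
  finally have "real m * k \<le> T" using m(2) by (simp add: field_simps)
  then show ?thesis using m unfolding k_def n_def T_def by blast
qed

section \<open>Edge-disjoint families from colour sums\<close>

lemma triangles_same_sum_edge_disjoint:
  assumes "K4_free V E" and c: "clique_colouring E V m c"
    and t: "is_triangle V E t1" "is_triangle V E t2" "t1 \<noteq> t2"
    and eq: "sum c t1 mod m = sum c t2 mod m"
  shows "tri_edges t1 \<inter> tri_edges t2 = {}"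
proof (rule ccontr)
  assume "\<not> ?thesis"
  then obtain e where e: "e \<subseteq> t1" "e \<subseteq> t2" "card e = 2" by (auto simp: tri_edges_def)
  have finite_e: "finite e" using e(3) card.infinite by fastforce
  have third: "\<exists>w. t = insert w e \<and> w \<notin> e" if "is_triangle V E t" "e \<subseteq> t" for t
  proof -
    have "card (t - e) = 1"
      using that e(3) finite_e by (simp add: is_triangle_def card_Diff_subset)
    then obtain w where "t - e = {w}" by (auto simp: card_1_singleton_iff)
    then show ?thesis using that(2) by blast
  qed
  obtain w1 w2 where w: "t1 = insert w1 e" "w1 \<notin> e" "t2 = insert w2 e" "w2 \<notin> e"
    using third t e by metis
  have V: "w1 \<in> V" "w2 \<in> V" "e \<subseteq> V" using t w by (auto simp: is_triangle_def)
  have "(c w1 + sum c e) mod m = (c w2 + sum c e) mod m"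
    using eq w finite_e by simp
  then have "c w1 mod m = c w2 mod m"
    by (metis cong_add_rcancel_nat cong_def)
  \<comment> \<open>Colours lie below \<open>m\<close>, so congruent colours are equal.\<close>
  then have "c w1 = c w2" using V c by (simp add: clique_colouring_def)
  moreover have "w1 \<noteq> w2" using t(3) w by auto
  ultimately have "{w1, w2} \<in> E" using V c by (auto simp: clique_colouring_def)
  \<comment> \<open>The only pair not inside \<open>t1\<close> or \<open>t2\<close> is
    \<open>{w1, w2}\<close>.\<close>
  then have "is_clique E (insert w1 (insert w2 e))"
    using t w unfolding is_triangle_def is_clique_def by (auto simp: insert_commute)
  moreover have "card (insert w1 (insert w2 e)) = 4"
    using \<open>w1 \<noteq> w2\<close> w finite_e e(3) by simp
  moreover have "insert w1 (insert w2 e) \<subseteq> V" using V by simp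
  ultimately show False using assms(1) unfolding K4_free_def by metis
qed

theorem theorem1:
  fixes V :: "'a set" and E :: "'a set set" and k :: real
  assumes "simple_graph V E"
    and "K4_free V E"
    and "k = real (card E) - (real (card V))\<^sup>2 / 4"
  shows "\<exists>T. edge_disjoint_triangles V E T \<and> finite T \<and> int (card T) \<ge> \<lceil>k\<rceil>"
proof (cases "V = {}")
  \<comment> \<open>An empty \<open>V\<close> has no nonempty critical subset; here
    \<open>k = 0\<close> and the empty family suffices.\<close>
  case True
  then have "E = {}" using assms(1) by (force simp: simple_graph_def)
  then show ?thesis
    using True assms(3) by (intro exI[of _ "{}"]) (simp add: edge_disjoint_triangles_def)
next
  case False
  define Tri where "Tri = {t. is_triangle V E t}"
  obtain m c where c: "clique_colouring E V m c" and "m > 0"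
    and T: "real m * k \<le> real (card Tri)"
    using K4_free_triangle_count[OF assms(1,2) False] unfolding assms(3) Tri_def by blast
  define Q where "Q s = {t \<in> Tri. sum c t mod m = s}" for s
  have "finite Tri"
    using assms(1) by (auto simp: Tri_def is_triangle_def simple_graph_def)
  have card_Tri: "card Tri = (\<Sum>s<m. card (Q s))"
    using sum.group[of Tri "{..<m}" "\<lambda>t. sum c t mod m" "\<lambda>_. 1::nat"] \<open>finite Tri\<close> \<open>m > 0\<close>
    by (simp add: Q_def image_subset_iff)
  \<comment> \<open>Averaging over the \<open>m\<close> residue classes.\<close>
  have "\<exists>s<m. k \<le> real (card (Q s))"
  proof (rule ccontr)
    assume "\<not> ?thesis"
    then have "(\<Sum>s<m. real (card (Q s))) < (\<Sum>s<m. k)"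
      using \<open>m > 0\<close> by (intro sum_strict_mono) (auto simp: not_le)
    then show False using T card_Tri by simp
  qed
  then obtain s where "k \<le> real (card (Q s))" by blast
  then have "\<lceil>k\<rceil> \<le> int (card (Q s))" by (simp add: ceiling_le_iff)
  moreover have "edge_disjoint_triangles V E (Q s)"
    unfolding edge_disjoint_triangles_def Q_def Tri_def
    using triangles_same_sum_edge_disjoint[OF assms(2) c] by auto
  ultimately show ?thesis
    using \<open>finite Tri\<close> by (intro exI[of _ "Q s"]) (auto simp: Q_def)
qed

end
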